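(* Let $d\ge 2$ and let $F_1,\dots,F_d$ be distribution functions with non-negative domain. (1) The upper bound $M$ is attained when $(X_1,\dots,X_d)$ is a comonotonic random vector, i.e. $X_i=F_i^{-1}(U)$, $i=1,\dots,d$, with $U\sim U[0,1]$. (2) Suppose the following mixing assumption holds: $(X_1,\dots,X_d)$ is a random vector with $X_i\sim F_i$ for all $i$ and $\sum_{i=1}^d \ln X_i=c$ a.s., where $c$ is a constant. Then $m=e^c$ and $m$ is attained by $(X_1,\dots,X_d)$.
   Context: All random variables $X_i\sim F_i$ are square integrable. $X\sim F$ means that $X$ has distribution function $F$, and $F^{-1}$ is the (generalized, left-continuous) inverse, i.e. the quantile function, of $F$. $F_i$ has non-negative domain if $X_i\sim F_i$ implies $X_i\ge 0$ a.s. Define $M=\sup \mathbb{E}(X_1X_2\cdots X_d)$ and $m=\inf \mathbb{E}(X_1X_2\cdots X_d)$, where the supremum and infimum are over all random vectors $(X_1,\dots,X_d)$ with $X_i\sim F_i$ for all $i$ and arbitrary dependence (expectations take values in $[0,\infty]$). A vector with $X_i\sim F_i$ for all $i$ attains $M$ (resp. $m$) if $\mathbb{E}(X_1\cdots X_d)$ equals $M$ (resp. $m$). *)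

theory Defs
  imports "HOL-Probability.Probability"
begin

definition distribution_function :: "(real \<Rightarrow> real) \<Rightarrow> bool" where
  "distribution_function F \<longleftrightarrow>
     mono F \<and> (\<forall>a. continuous (at_right a) F) \<and> (F \<longlongrightarrow> 0) at_bot \<and> (F \<longlongrightarrow> 1) at_top"

definition has_df :: "'a measure \<Rightarrow> ('a \<Rightarrow> real) \<Rightarrow> (real \<Rightarrow> real) \<Rightarrow> bool" where
  "has_df P X F \<longleftrightarrow> prob_space P \<and> X \<in> borel_measurable P \<and> cdf (distr P borel X) = F"

text \<open>Only the values on the open unit interval are meaningful: at \<open>0\<close> and \<open>1\<close> the
  infimum may be that of an unbounded or empty set of reals, which is unspecified.\<close>

definition quantile :: "(real \<Rightarrow> real) \<Rightarrow> real \<Rightarrow> real" where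
  "quantile F u = Inf {x. u \<le> F x}"

text \<open>A formula cannot quantify over all sample space types. The next two definitions let the
  underlying probability space range over all probability spaces on the reals; this is no
  restriction, by the lemmas following them.\<close>

definition nonneg_domain :: "(real \<Rightarrow> real) \<Rightarrow> bool" where
  "nonneg_domain F \<longleftrightarrow> (\<forall>(P :: real measure) X. has_df P X F \<longrightarrow> (AE \<omega> in P. 0 \<le> X \<omega>))"

definition square_integrable_df :: "(real \<Rightarrow> real) \<Rightarrow> bool" where
  "square_integrable_df F \<longleftrightarrow>
     (\<forall>(P :: real measure) X. has_df P X F \<longrightarrow> integrable P (\<lambda>\<omega>. (X \<omega>)\<^sup>2))"

lemma has_df_distr: "has_df P X F \<Longrightarrow> has_df (distr P borel X) (\<lambda>x. x) F"
  by (auto simp: has_df_def prob_space.prob_space_distr distr_distr comp_def)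

lemma nonneg_domainD:
  assumes "nonneg_domain F" "has_df P X F"
  shows "AE \<omega> in P. 0 \<le> X \<omega>"
proof -
  have "AE x in distr P borel X. 0 \<le> x"
    using assms has_df_distr unfolding nonneg_domain_def by blast
  then show ?thesis
    using assms(2) by (simp add: has_df_def AE_distr_iff)
qed

lemma square_integrable_dfD:
  assumes "square_integrable_df F" "has_df P X F"
  shows "integrable P (\<lambda>\<omega>. (X \<omega>)\<^sup>2)"
proof -
  have "integrable (distr P borel X) (\<lambda>x. x\<^sup>2)"
    using assms has_df_distr unfolding square_integrable_df_def by blast
  then show ?thesis
    using assms(2) by (simp add: has_df_def integrable_distr_eq)
qed

definition has_marginals :: "'a measure \<Rightarrow> nat \<Rightarrow> (nat \<Rightarrow> real \<Rightarrow> real) \<Rightarrow> (nat \<Rightarrow> 'a \<Rightarrow> real) \<Rightarrow> bool" where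
  "has_marginals P d F X \<longleftrightarrow> (\<forall>i\<in>{1..d}. has_df P (X i) (F i))"

text \<open>The expectation is a non-negative Lebesgue integral, so it may be infinite. It is only used
  for factors that are almost surely non-negative, where the truncation by \<^const>\<open>ennreal\<close> is
  harmless.\<close>

definition expected_product :: "'a measure \<Rightarrow> nat \<Rightarrow> (nat \<Rightarrow> 'a \<Rightarrow> real) \<Rightarrow> ennreal" where
  "expected_product P d X = (\<integral>\<^sup>+ \<omega>. ennreal (\<Prod>i\<in>{1..d}. X i \<omega>) \<partial>P)"

text \<open>Again, sample spaces of type \<^typ>\<open>nat \<Rightarrow> real\<close> suffice, since every random vector has the
  same law as the coordinate process on such a space; see \<open>expected_product_attainable\<close>.\<close>

definition attainable_expectations :: "nat \<Rightarrow> (nat \<Rightarrow> real \<Rightarrow> real) \<Rightarrow> ennreal set" where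
  "attainable_expectations d F =
     {expected_product P d X | (P :: (nat \<Rightarrow> real) measure) X. has_marginals P d F X}"

lemma expected_product_attainable:
  fixes P :: "'a measure"
  assumes "has_marginals P d F X" and "1 \<le> d"
  shows "expected_product P d X \<in> attainable_expectations d F"
proof -
  let ?S = "PiM {1..d} (\<lambda>_. borel :: real measure)"
  let ?T = "\<lambda>\<omega>. \<lambda>i\<in>{1..d}. X i \<omega>"
  let ?Q = "distr P ?S ?T"
  have meas: "X i \<in> borel_measurable P" if "i \<in> {1..d}" for i
    using assms(1) that by (auto simp: has_marginals_def has_df_def)
  have "prob_space P"
    using assms by (auto simp: has_marginals_def has_df_def)
  have T [measurable]: "?T \<in> measurable P ?S"
    using meas by (intro measurable_restrict) auto
  have "has_marginals ?Q d F (\<lambda>i x. x i)"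
    unfolding has_marginals_def has_df_def
  proof (intro ballI conjI)
    fix i assume i: "i \<in> {1..d}"
    show "prob_space ?Q"
      using \<open>prob_space P\<close> T by (rule prob_space.prob_space_distr)
    have coord: "(\<lambda>x. x i) \<in> borel_measurable ?S"
      using i by (rule measurable_component_singleton)
    then show "(\<lambda>x. x i) \<in> borel_measurable ?Q"
      by simp
    have "distr ?Q borel (\<lambda>x. x i) = distr P borel (X i)"
      using i by (subst distr_distr[OF coord T]) (simp add: comp_def)
    then show "cdf (distr ?Q borel (\<lambda>x. x i)) = F i"
      using assms(1) i by (simp add: has_marginals_def has_df_def)
  qed
  moreover have "expected_product ?Q d (\<lambda>i x. x i) = expected_product P d X"
  proof -
    have "(\<lambda>x. ennreal (\<Prod>i\<in>{1..d}. x i)) \<in> borel_measurable ?S"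
      by (intro measurable_compose[OF _ measurable_ennreal] borel_measurable_prod
          measurable_component_singleton)
    then show ?thesis
      unfolding expected_product_def by (subst nn_integral_distr[OF T]) auto
  qed
  ultimately show ?thesis
    unfolding attainable_expectations_def by force
qed

definition upper_bound_M :: "nat \<Rightarrow> (nat \<Rightarrow> real \<Rightarrow> real) \<Rightarrow> ennreal" where
  "upper_bound_M d F = Sup (attainable_expectations d F)"

definition lower_bound_m :: "nat \<Rightarrow> (nat \<Rightarrow> real \<Rightarrow> real) \<Rightarrow> ennreal" where
  "lower_bound_m d F = Inf (attainable_expectations d F)"

definition attains_M :: "'a measure \<Rightarrow> nat \<Rightarrow> (nat \<Rightarrow> real \<Rightarrow> real) \<Rightarrow> (nat \<Rightarrow> 'a \<Rightarrow> real) \<Rightarrow> bool" where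
  "attains_M P d F X \<longleftrightarrow> has_marginals P d F X \<and> expected_product P d X = upper_bound_M d F"

definition attains_m :: "'a measure \<Rightarrow> nat \<Rightarrow> (nat \<Rightarrow> real \<Rightarrow> real) \<Rightarrow> (nat \<Rightarrow> 'a \<Rightarrow> real) \<Rightarrow> bool" where
  "attains_m P d F X \<longleftrightarrow> has_marginals P d F X \<and> expected_product P d X = lower_bound_m d F"

text \<open>Equality of random variables is almost sure equality, so that the unspecified values of
  \<^const>\<open>quantile\<close> at \<open>0\<close> and \<open>1\<close> play no role. That the components have the
  prescribed marginals is not part of the definition.\<close>

definition comonotonic :: "'a measure \<Rightarrow> nat \<Rightarrow> (nat \<Rightarrow> real \<Rightarrow> real) \<Rightarrow> (nat \<Rightarrow> 'a \<Rightarrow> real) \<Rightarrow> bool" where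
  "comonotonic P d F X \<longleftrightarrow>
     prob_space P \<and> (\<forall>i\<in>{1..d}. X i \<in> borel_measurable P) \<and>
     (\<exists>U \<in> borel_measurable P. distr P borel U = uniform_measure lborel {0..1} \<and>
        (\<forall>i\<in>{1..d}. AE \<omega> in P. X i \<omega> = quantile (F i) (U \<omega>)))"

text \<open>The logarithm with \<open>ln 0 = -\<infinity>\<close>; the library's \<^term>\<open>ln (0 :: real)\<close> is \<open>0\<close>.\<close>

definition ext_ln :: "real \<Rightarrow> ereal" where
  "ext_ln x = (if x \<le> 0 then -\<infinity> else ereal (ln x))"

end

theory Submission
  imports Defs
begin

text \<open>(1) Writing each factor as \<open>X i = (\<integral>t\<ge>0. 1{t < X i})\<close> and applying Tonelli expresses the
  expected product as the integral of the joint survival function over the positive orthant. At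
  every point \<open>t\<close> that function is at most the smallest marginal survival probability
  \<open>1 - F i (t i)\<close>, and the comonotonic vector attains this bound, because
  \<open>t < quantile F u\<close> is equivalent to \<open>F t < u\<close>.

  (2) On the mixing vector the product is \<open>exp c\<close>. Since \<open>ln (X i)\<close> is bounded above by \<open>X i\<close> and,
  by the mixing condition, below by \<open>c\<close> minus the sum of the other factors, it is integrable, so the
  logarithms of any vector with the same marginals have total expectation \<open>c\<close>. Jensen's inequality
  for \<open>exp\<close> gives the bound.\<close>

section \<open>Layer-cake formula for the expected product\<close>

lemma nn_integral_indicator_Ico:
  "(\<integral>\<^sup>+t. indicator {0..<x} t \<partial>lborel) = ennreal x" for x :: real
  \<comment> \<open>For negative \<open>x\<close> the interval is empty and \<open>ennreal\<close>
    truncates to 0.\<close>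
  by (cases "0 \<le> x") (simp_all add: ennreal_neg)

text \<open>The right-hand side depends on the vector only through its joint survival function, so
  vectors on different sample spaces become comparable pointwise in \<open>t\<close>.\<close>

lemma nn_integral_prod_survival:
  fixes X :: "'i \<Rightarrow> 'a \<Rightarrow> real"
  assumes "prob_space P" and I: "finite I"
    and meas: "\<And>i. i \<in> I \<Longrightarrow> X i \<in> borel_measurable P"
    and nonneg: "\<And>i. i \<in> I \<Longrightarrow> AE \<omega> in P. 0 \<le> X i \<omega>"
  shows "(\<integral>\<^sup>+\<omega>. ennreal (\<Prod>i\<in>I. X i \<omega>) \<partial>P) =
    (\<integral>\<^sup>+t. indicator {t. \<forall>i\<in>I. 0 \<le> t i} t * emeasure P {\<omega>\<in>space P. \<forall>i\<in>I. t i < X i \<omega>}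
       \<partial>PiM I (\<lambda>_. lborel))"
proof -
  interpret P: prob_space P by fact
  interpret L: product_sigma_finite "\<lambda>_::'i. lborel :: real measure" ..
  interpret LI: finite_product_sigma_finite "\<lambda>_::'i. lborel :: real measure" I
    by unfold_locales (rule I)
  let ?L = "PiM I (\<lambda>_. lborel :: real measure)"
  interpret PL: pair_sigma_finite P ?L
    by unfold_locales
  \<comment> \<open>The indicator of the box with sides [0, \<open>X i \<omega>\<close>), kept as a
    product so that its integral over \<open>t\<close> factorises.\<close>
  let ?g = "\<lambda>\<omega> t. (\<Prod>i\<in>I. indicator {0..<X i \<omega>} (t i)) :: ennreal"
  \<comment> \<open>The sign conditions on \<open>t\<close> split off and leave the integral over
    \<omega> as a constant factor.\<close>
  have g_eq: "?g \<omega> t = indicator {t. \<forall>i\<in>I. 0 \<le> t i} t * indicator {\<omega>. \<forall>i\<in>I. t i < X i \<omega>} \<omega>"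
    for \<omega> t
    using I by (induction I) (auto simp: indicator_def)
  have g_meas: "(\<lambda>(\<omega>, t). ?g \<omega> t) \<in> borel_measurable (P \<Otimes>\<^sub>M ?L)"
  proof -
    have "(\<lambda>x. indicator {0..<X i (fst x)} (snd x i) :: ennreal) \<in> borel_measurable (P \<Otimes>\<^sub>M ?L)"
      if i: "i \<in> I" for i
    proof -
      have [measurable]: "(\<lambda>x. X i (fst x)) \<in> borel_measurable (P \<Otimes>\<^sub>M ?L)"
        by (rule measurable_compose[OF measurable_fst meas[OF i]])
      have "(\<lambda>t. t i) \<in> measurable ?L lborel"
        by (rule measurable_component_singleton[OF i])
      then have [measurable]: "(\<lambda>x. snd x i) \<in> borel_measurable (P \<Otimes>\<^sub>M ?L)"
        by (intro measurable_compose[OF measurable_snd]) simp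
      \<comment> \<open>The set under the indicator moves with \<open>x\<close>; the conditional
        form reduces measurability to comparing measurable functions.\<close>
      have "(\<lambda>x. indicator {0..<X i (fst x)} (snd x i) :: ennreal) =
          (\<lambda>x. if 0 \<le> snd x i \<and> snd x i < X i (fst x) then 1 else 0)"
        by (auto simp: indicator_def)
      then show ?thesis
        by simp
    qed
    then show ?thesis
      unfolding split_beta by (intro borel_measurable_prod_ennreal)
  qed
  have "(\<integral>\<^sup>+\<omega>. ennreal (\<Prod>i\<in>I. X i \<omega>) \<partial>P) = (\<integral>\<^sup>+\<omega>. (\<integral>\<^sup>+t. ?g \<omega> t \<partial>?L) \<partial>P)"
  proof (rule nn_integral_cong_AE)
    have "AE \<omega> in P. \<forall>i\<in>I. 0 \<le> X i \<omega>"
      using nonneg I by (simp add: AE_finite_all)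
    then show "AE \<omega> in P. ennreal (\<Prod>i\<in>I. X i \<omega>) = (\<integral>\<^sup>+t. ?g \<omega> t \<partial>?L)"
    proof eventually_elim
      case (elim \<omega>)
      have "(\<integral>\<^sup>+t. ?g \<omega> t \<partial>?L) = (\<Prod>i\<in>I. \<integral>\<^sup>+t. indicator {0..<X i \<omega>} t \<partial>lborel)"
        by (intro L.product_nn_integral_prod I) simp
      with elim show ?case
        by (simp only: nn_integral_indicator_Ico) (simp add: prod_ennreal)
    qed
  qed
  also have "\<dots> = (\<integral>\<^sup>+t. (\<integral>\<^sup>+\<omega>. ?g \<omega> t \<partial>P) \<partial>?L)"
    by (rule PL.Fubini'[OF g_meas, symmetric])
  also have "\<dots> = (\<integral>\<^sup>+t. indicator {t. \<forall>i\<in>I. 0 \<le> t i} t *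
      emeasure P {\<omega>\<in>space P. \<forall>i\<in>I. t i < X i \<omega>} \<partial>?L)"
  proof (rule nn_integral_cong)
    fix t
    have A: "{\<omega>\<in>space P. \<forall>i\<in>I. t i < X i \<omega>} \<in> sets P"
      using I meas by (intro sets.sets_Collect_finite_All) auto
    have "(\<integral>\<^sup>+\<omega>. ?g \<omega> t \<partial>P) = (\<integral>\<^sup>+\<omega>. indicator {t. \<forall>i\<in>I. 0 \<le> t i} t *
        indicator {\<omega>\<in>space P. \<forall>i\<in>I. t i < X i \<omega>} \<omega> \<partial>P)"
      unfolding g_eq by (intro nn_integral_cong) (auto simp: indicator_def)
    also have "\<dots> = indicator {t. \<forall>i\<in>I. 0 \<le> t i} t * emeasure P {\<omega>\<in>space P. \<forall>i\<in>I. t i < X i \<omega>}"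
      using A by (rule nn_integral_cmult_indicator)
    finally show "(\<integral>\<^sup>+\<omega>. ?g \<omega> t \<partial>P) =
        indicator {t. \<forall>i\<in>I. 0 \<le> t i} t * emeasure P {\<omega>\<in>space P. \<forall>i\<in>I. t i < X i \<omega>}" .
  qed
  finally show ?thesis .
qed

section \<open>Distribution functions, quantiles and uniform variables\<close>

lemma distribution_function_bounds:
  assumes "distribution_function F"
  shows "0 \<le> F x" "F x \<le> 1"
proof -
  have mono: "mono F" and bot: "(F \<longlongrightarrow> 0) at_bot" and top: "(F \<longlongrightarrow> 1) at_top"
    using assms by (auto simp: distribution_function_def)
  have "eventually (\<lambda>y. F y \<le> F x) at_bot"
    using eventually_le_at_bot[of x] by eventually_elim (rule monoD[OF mono])
  then show "0 \<le> F x"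
    by (rule tendsto_upperbound[OF bot]) simp
  have "eventually (\<lambda>y. F x \<le> F y) at_top"
    using eventually_ge_at_top[of x] by eventually_elim (rule monoD[OF mono])
  then show "F x \<le> 1"
    by (rule tendsto_lowerbound[OF top]) simp
qed

text \<open>The Galois connection between \<open>F\<close> and its generalized inverse, negated on
  both sides. Left to right, the infimum is a lower bound; right to left, right-continuity keeps
  \<open>F\<close> below \<open>u\<close> slightly beyond \<open>t\<close>. The limits of
  \<open>F\<close> make the set bounded below and nonempty for \<open>u\<close> in the open
  interval.\<close>

lemma less_quantile_iff:
  assumes F: "distribution_function F" and u: "0 < u" "u < 1"
  shows "t < quantile F u \<longleftrightarrow> F t < u"
proof -
  have mono: "mono F" and right: "continuous (at_right a) F"
    and bot: "(F \<longlongrightarrow> 0) at_bot" and top: "(F \<longlongrightarrow> 1) at_top" for a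
    using F by (auto simp: distribution_function_def)
  let ?S = "{x. u \<le> F x}"
  obtain b where b: "F b < u"
    using order_tendstoD(2)[OF bot u(1)] eventually_happens[of _ "at_bot :: real filter"] by auto
  have bdd: "bdd_below ?S"
  proof (rule bdd_belowI)
    fix x assume "x \<in> ?S"
    then show "b \<le> x"
      using b monoD[OF mono, of x b] by force
  qed
  obtain a where a: "u \<le> F a"
    using order_tendstoD(1)[OF top u(2)] eventually_happens[of _ "at_top :: real filter"]
    by (auto intro: less_imp_le)
  show ?thesis
  proof
    assume t: "t < quantile F u"
    show "F t < u"
    proof (rule ccontr)
      assume "\<not> F t < u"
      then have "quantile F u \<le> t"
        unfolding quantile_def by (intro cInf_lower bdd) simp
      with t show False by simp
    qed
  next
    assume t: "F t < u"
    have "(F \<longlongrightarrow> F t) (at_right t)"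
      using right[of t] by (simp add: continuous_within)
    then have "eventually (\<lambda>y. F y < u) (at_right t)"
      by (rule order_tendstoD(2)) (rule t)
    \<comment> \<open>A point strictly right of \<open>t\<close> that still bounds \<open>?S\<close>
      from below; this gap yields the strict inequality.\<close>
    then obtain s where s: "t < s" "F s < u"
      unfolding eventually_at_right_field by (meson dense)
    have "s \<le> quantile F u"
      unfolding quantile_def
    proof (rule cInf_greatest)
      show "?S \<noteq> {}" using a by auto
      fix x assume "x \<in> ?S"
      then show "s \<le> x"
        using s monoD[OF mono, of x s] by force
    qed
    with s show "t < quantile F u" by simp
  qed
qed

context prob_space
begin

text \<open>Confines \<open>U\<close> almost surely to the range on which \<open>quantile\<close> is
  meaningful.\<close>

lemma uniform_in_unit_AE:
  assumes U: "U \<in> borel_measurable M" "distr M borel U = uniform_measure lborel {0..1::real}"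
  shows "AE \<omega> in M. 0 < U \<omega> \<and> U \<omega> < 1"
proof -
  have "AE u in lborel. u \<noteq> 0 \<and> u \<noteq> (1::real)"
    using AE_lborel_singleton[of "0::real"] AE_lborel_singleton[of "1::real"] by eventually_elim auto
  then have "AE u in uniform_measure lborel {0..1}. 0 < u \<and> u < (1::real)"
    by (intro AE_uniform_measureI) (auto simp: AE_conj_iff)
  then show ?thesis
    unfolding U(2)[symmetric] using U(1) by (subst (asm) AE_distr_iff) auto
qed

lemma uniform_survival:
  assumes U: "U \<in> borel_measurable M" "distr M borel U = uniform_measure lborel {0..1::real}"
    and p: "0 \<le> p" "p \<le> 1"
  shows "prob {\<omega>\<in>space M. p < U \<omega>} = 1 - p"
proof -
  have "prob {\<omega>\<in>space M. p < U \<omega>} = measure (distr M borel U) {p<..}"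
    using U(1) by (subst measure_distr) (auto intro!: arg_cong[where f=prob])
  also have "\<dots> = measure lborel ({0..1} \<inter> {p<..}) / measure lborel {0..1::real}"
    unfolding U(2) by (rule measure_uniform_measure) simp_all
  also have "{0..1} \<inter> {p<..} = {p<..1}"
    using p by auto
  finally show ?thesis
    using p by simp
qed

end

section \<open>Survival probabilities of marginals and comonotonic vectors\<close>

lemma has_df_survival:
  assumes "has_df P X F"
  shows "measure P {\<omega>\<in>space P. t < X \<omega>} = 1 - F t"
proof -
  interpret prob_space P using assms by (simp add: has_df_def)
  have X [measurable]: "X \<in> borel_measurable P" and cdf: "cdf (distr P borel X) = F"
    using assms by (auto simp: has_df_def)
  have "F t = prob {\<omega>\<in>space P. X \<omega> \<le> t}"
    unfolding cdf[symmetric] cdf_def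
    by (subst measure_distr) (auto intro!: arg_cong[where f=prob])
  moreover have "prob {\<omega>\<in>space P. \<not> X \<omega> \<le> t} = 1 - prob {\<omega>\<in>space P. X \<omega> \<le> t}"
    by (rule prob_neg) measurable
  ultimately show ?thesis
    by (simp add: not_le)
qed

lemma has_df_survivalI:
  assumes "prob_space P" and X [measurable]: "X \<in> borel_measurable P"
    and survival: "\<And>t. measure P {\<omega>\<in>space P. t < X \<omega>} = 1 - F t"
  shows "has_df P X F"
proof -
  \<comment> \<open>\<open>X\<close> trivially has its own cdf; its survival probabilities then
    identify that cdf with \<open>F\<close>.\<close>
  have "has_df P X (cdf (distr P borel X))"
    using assms by (simp add: has_df_def)
  from has_df_survival[OF this] survival have "cdf (distr P borel X) t = F t" for t
    by simp
  then show ?thesis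
    using assms by (auto simp: has_df_def)
qed

text \<open>Each event \<open>t i < X i \<omega>\<close> becomes
  \<open>F i (t i) < U \<omega>\<close> almost surely. These events are nested, so their
  intersection is the one with the largest threshold, at \<open>j\<close>. A singleton
  \<open>J\<close> gives the marginals, the full index set the joint survival function.\<close>

lemma comonotonic_survival:
  fixes X :: "nat \<Rightarrow> 'a \<Rightarrow> real"
  assumes df: "\<And>i. i \<in> {1..d} \<Longrightarrow> distribution_function (F i)"
    and X: "comonotonic P d F X"
    and J: "J \<subseteq> {1..d}" "j \<in> J" and le: "\<And>i. i \<in> J \<Longrightarrow> F i (t i) \<le> F j (t j)"
  shows "measure P {\<omega>\<in>space P. \<forall>i\<in>J. t i < X i \<omega>} = 1 - F j (t j)"
proof -
  interpret prob_space P using X by (simp add: comonotonic_def)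
  obtain U where U: "U \<in> borel_measurable P" "distr P borel U = uniform_measure lborel {0..1}"
    and XU: "\<And>i. i \<in> {1..d} \<Longrightarrow> AE \<omega> in P. X i \<omega> = quantile (F i) (U \<omega>)"
    using X by (auto simp: comonotonic_def)
  have [measurable]: "U \<in> borel_measurable P" "\<And>i. i \<in> J \<Longrightarrow> X i \<in> borel_measurable P"
    using U(1) X J by (auto simp: comonotonic_def)
  have J_fin: "finite J"
    using J(1) by (rule finite_subset) simp
  have "AE \<omega> in P. \<forall>i\<in>J. X i \<omega> = quantile (F i) (U \<omega>)"
    using XU J(1) J_fin by (subst AE_finite_all) auto
  with uniform_in_unit_AE[OF U]
  have AE: "AE \<omega> in P. (\<forall>i\<in>J. t i < X i \<omega>) \<longleftrightarrow> F j (t j) < U \<omega>"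
  proof eventually_elim
    case (elim \<omega>)
    then have "t i < X i \<omega> \<longleftrightarrow> F i (t i) < U \<omega>" if "i \<in> J" for i
      using that J(1) less_quantile_iff[OF df, of i "U \<omega>" "t i"] by auto
    then show ?case
      using J(2) le by (auto intro: le_less_trans)
  qed
  have "prob {\<omega>\<in>space P. \<forall>i\<in>J. t i < X i \<omega>} = prob {\<omega>\<in>space P. F j (t j) < U \<omega>}"
    using AE J_fin
    by (intro measure_eq_AE sets.sets_Collect_finite_All) auto
  also have "\<dots> = 1 - F j (t j)"
    using J distribution_function_bounds[OF df] by (intro uniform_survival U) auto
  finally show ?thesis .
qed

lemma comonotonic_has_marginals:
  assumes df: "\<And>i. i \<in> {1..d} \<Longrightarrow> distribution_function (F i)"
    and X: "comonotonic P d F X"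
  shows "has_marginals P d F X"
  unfolding has_marginals_def
proof
  fix i assume i: "i \<in> {1..d}"
  show "has_df P (X i) (F i)"
  proof (rule has_df_survivalI)
    show "prob_space P" "X i \<in> borel_measurable P"
      using X i by (auto simp: comonotonic_def)
    fix t
    show "measure P {\<omega>\<in>space P. t < X i \<omega>} = 1 - F i t"
      using comonotonic_survival[OF df X, of "{i}" i "\<lambda>_. t"] i by simp
  qed
qed

section \<open>Maximality of the comonotonic vector\<close>

lemma expected_product_survival:
  assumes "1 \<le> d" and "has_marginals P d F X"
    and "\<And>i. i \<in> {1..d} \<Longrightarrow> nonneg_domain (F i)"
  shows "expected_product P d X =
    (\<integral>\<^sup>+t. indicator {t. \<forall>i\<in>{1..d}. 0 \<le> t i} t *
       emeasure P {\<omega>\<in>space P. \<forall>i\<in>{1..d}. t i < X i \<omega>} \<partial>PiM {1..d} (\<lambda>_. lborel))"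
  unfolding expected_product_def
proof (rule nn_integral_prod_survival)
  show "prob_space P"
    using assms by (auto simp: has_marginals_def has_df_def)
qed (use assms in \<open>auto simp: has_marginals_def has_df_def intro!: nonneg_domainD\<close>)

lemma expected_product_le_comonotonic:
  assumes d: "1 \<le> d"
    and df: "\<And>i. i \<in> {1..d} \<Longrightarrow> distribution_function (F i)"
    and nonneg: "\<And>i. i \<in> {1..d} \<Longrightarrow> nonneg_domain (F i)"
    and X: "comonotonic P d F X" and Y: "has_marginals Q d F Y"
  shows "expected_product Q d Y \<le> expected_product P d X"
proof -
  interpret P: prob_space P using X by (simp add: comonotonic_def)
  interpret Q: prob_space Q using Y d by (auto simp: has_marginals_def has_df_def)
  have *: "emeasure Q {\<omega>\<in>space Q. \<forall>i\<in>{1..d}. t i < Y i \<omega>}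
      \<le> emeasure P {\<omega>\<in>space P. \<forall>i\<in>{1..d}. t i < X i \<omega>}" for t
  proof -
    have "finite {1..d}" "{1..d} \<noteq> {}" using d by auto
    \<comment> \<open>The largest \<open>F i (t i)\<close> belongs to the smallest marginal survival
      probability, which bounds the joint one for any dependence.\<close>
    then obtain j where j: "j \<in> {1..d}" "\<And>i. i \<in> {1..d} \<Longrightarrow> F i (t i) \<le> F j (t j)"
      using Max_in[of "(\<lambda>i. F i (t i)) ` {1..d}"] Max_ge[of "(\<lambda>i. F i (t i)) ` {1..d}"]
      by (smt (verit, best) finite_imageI image_is_empty imageE imageI)
    have df_j: "has_df Q (Y j) (F j)"
      using Y j(1) by (auto simp: has_marginals_def)
    then have [measurable]: "Y j \<in> borel_measurable Q"
      by (simp add: has_df_def)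
    have "Q.prob {\<omega>\<in>space Q. \<forall>i\<in>{1..d}. t i < Y i \<omega>} \<le> Q.prob {\<omega>\<in>space Q. t j < Y j \<omega>}"
      using j(1) by (intro Q.finite_measure_mono) auto
    also have "\<dots> = 1 - F j (t j)"
      by (rule has_df_survival[OF df_j])
    also have "\<dots> = P.prob {\<omega>\<in>space P. \<forall>i\<in>{1..d}. t i < X i \<omega>}"
      using j by (intro comonotonic_survival[OF df X, symmetric]) auto
    finally show ?thesis
      by (simp add: P.emeasure_eq_measure Q.emeasure_eq_measure ennreal_leI)
  qed
  have X_marg: "has_marginals P d F X"
    using df X by (rule comonotonic_has_marginals)
  show ?thesis
    using d nonneg Y X_marg
    by (simp only: expected_product_survival) (intro nn_integral_mono mult_left_mono *, simp)
qed

lemma comonotonic_attains_M: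
  assumes "1 \<le> d"
    and "\<And>i. i \<in> {1..d} \<Longrightarrow> distribution_function (F i)"
    and "\<And>i. i \<in> {1..d} \<Longrightarrow> nonneg_domain (F i)"
    and X: "comonotonic P d F X"
  shows "attains_M P d F X"
proof -
  have marg: "has_marginals P d F X"
    using assms by (intro comonotonic_has_marginals)
  have "upper_bound_M d F \<le> expected_product P d X"
    unfolding upper_bound_M_def attainable_expectations_def
    using expected_product_le_comonotonic[OF assms] by (intro Sup_least) blast
  \<comment> \<open>\<open>P\<close> may have any sample space type, while the supremum ranges over
    spaces on \<open>nat \<Rightarrow> real\<close>; the value is carried over by the joint
    law.\<close>
  moreover have "expected_product P d X \<le> upper_bound_M d F"
    unfolding upper_bound_M_def
    using marg \<open>1 \<le> d\<close> by (intro Sup_upper expected_product_attainable)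
  ultimately show ?thesis
    using marg by (simp add: attains_M_def)
qed

section \<open>Logarithms and the exponential lower bound\<close>

text \<open>Serves to carry positivity and the expectations of \<open>ln\<close> from the mixing
  vector to its competitors.\<close>

lemma has_df_distr_unique:
  assumes "has_df P X F" "has_df Q Y F"
  shows "distr P borel X = distr Q borel Y"
proof (rule cdf_unique)
  show "real_distribution (distr P borel X)" "real_distribution (distr Q borel Y)"
    using assms by (auto simp: has_df_def intro!: prob_space.real_distribution_distr)
  show "cdf (distr P borel X) = cdf (distr Q borel Y)"
    using assms by (simp add: has_df_def)
qed

text \<open>A single factor that is not positive would force the sum to -\<infinity>, against the
  finite \<open>c\<close>.\<close>

lemma sum_ext_ln_eq_real:
  assumes I: "finite I" and sum: "(\<Sum>i\<in>I. ext_ln (x i)) = ereal c"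
  shows "\<forall>i\<in>I. 0 < x i" and "(\<Sum>i\<in>I. ln (x i)) = c"
proof -
  show pos: "\<forall>i\<in>I. 0 < x i"
  proof (rule ccontr)
    assume "\<not> (\<forall>i\<in>I. 0 < x i)"
    then obtain i where i: "i \<in> I" "ext_ln (x i) = -\<infinity>"
      by (auto simp: ext_ln_def not_less)
    \<comment> \<open>In \<open>ereal\<close>, \<infinity> + -\<infinity> is \<infinity>, so the
      remaining terms must be shown not to reach \<infinity>.\<close>
    have "(\<Sum>i\<in>I - {i}. ext_ln (x i)) \<noteq> \<infinity>"
      using I by (auto simp: sum_Pinfty ext_ln_def)
    then have "(\<Sum>i\<in>I. ext_ln (x i)) = -\<infinity>"
      using i I by (simp add: sum.remove)
    with sum show False by simp
  qed
  then have "(\<Sum>i\<in>I. ext_ln (x i)) = ereal (\<Sum>i\<in>I. ln (x i))"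
    by (subst sum_ereal[symmetric], intro sum.cong) (auto simp: ext_ln_def not_le)
  with sum show "(\<Sum>i\<in>I. ln (x i)) = c" by simp
qed

lemma (in prob_space) integrable_ln_of_sum_eq:
  fixes X :: "'i \<Rightarrow> 'a \<Rightarrow> real"
  assumes I: "finite I" "i \<in> I"
    and int: "\<And>i. i \<in> I \<Longrightarrow> integrable M (X i)"
    and pos: "AE \<omega> in M. \<forall>i\<in>I. 0 < X i \<omega>"
    and sum: "AE \<omega> in M. (\<Sum>i\<in>I. ln (X i \<omega>)) = c"
  shows "integrable M (\<lambda>\<omega>. ln (X i \<omega>))"
proof (rule Bochner_Integration.integrable_bound)
  \<comment> \<open>One dominating function serves both sides: \<open>ln x \<le> x\<close> bounds
    from above, and solving the sum condition for \<open>ln (X i \<omega>)\<close> bounds from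
    below.\<close>
  show "integrable M (\<lambda>\<omega>. \<bar>c\<bar> + (\<Sum>i\<in>I. X i \<omega>))"
    using int by simp
  show "(\<lambda>\<omega>. ln (X i \<omega>)) \<in> borel_measurable M"
    using int I by (intro borel_measurable_ln borel_measurable_integrable) auto
  show "AE \<omega> in M. norm (ln (X i \<omega>)) \<le> norm (\<bar>c\<bar> + (\<Sum>i\<in>I. X i \<omega>))"
    using pos sum
  proof eventually_elim
    case (elim \<omega>)
    have le: "ln (X k \<omega>) \<le> X k \<omega>" if "k \<in> I" for k
      using elim(1) that ln_le_minus_one[of "X k \<omega>"] by force
    have nonneg: "0 \<le> (\<Sum>k\<in>I - {i}. X k \<omega>)"
      using elim(1) by (intro sum_nonneg) (auto intro: less_imp_le)
    have pos_i: "0 < X i \<omega>"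
      using elim(1) I(2) by blast
    have split: "(\<Sum>k\<in>I. X k \<omega>) = X i \<omega> + (\<Sum>k\<in>I - {i}. X k \<omega>)"
      "c = ln (X i \<omega>) + (\<Sum>k\<in>I - {i}. ln (X k \<omega>))"
      using I elim(2) by (simp_all add: sum.remove)
    have "(\<Sum>k\<in>I - {i}. ln (X k \<omega>)) \<le> (\<Sum>k\<in>I - {i}. X k \<omega>)"
      by (intro sum_mono le) auto
    with split nonneg pos_i le[OF I(2)] show ?case
      unfolding real_norm_def by linarith
  qed
qed

text \<open>Truncating negative values to 0 can only raise the integral. This is applied to a
  tangent that may be negative.\<close>

lemma ennreal_integral_le_nn_integral:
  fixes f :: "'a \<Rightarrow> real"
  assumes "integrable M f"
  shows "ennreal (\<integral>x. f x \<partial>M) \<le> (\<integral>\<^sup>+x. ennreal (f x) \<partial>M)"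
proof -
  have "(\<integral>x. f x \<partial>M) \<le> (\<integral>x. max 0 (f x) \<partial>M)"
    using assms by (intro integral_mono) auto
  also have "ennreal \<dots> = (\<integral>\<^sup>+x. ennreal (max 0 (f x)) \<partial>M)"
    using assms by (intro nn_integral_eq_integral[symmetric]) auto
  finally show ?thesis
    by (simp add: ennreal_leI)
qed

text \<open>Jensen's inequality by a tangent line: the product may have infinite expectation, so it
  is compared pointwise with an integrable affine function of the logarithms, whose expectation is
  the value of \<open>exp\<close> at their total mean.\<close>

lemma (in prob_space) nn_integral_prod_ge_exp:
  fixes X :: "'i \<Rightarrow> 'a \<Rightarrow> real"
  assumes I: "finite I"
    and pos: "AE \<omega> in M. \<forall>i\<in>I. 0 < X i \<omega>"
    and int: "\<And>i. i \<in> I \<Longrightarrow> integrable M (\<lambda>\<omega>. ln (X i \<omega>))"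
  shows "ennreal (exp (\<Sum>i\<in>I. expectation (\<lambda>\<omega>. ln (X i \<omega>)))) \<le> (\<integral>\<^sup>+\<omega>. ennreal (\<Prod>i\<in>I. X i \<omega>) \<partial>M)"
proof -
  define c where "c = (\<Sum>i\<in>I. expectation (\<lambda>\<omega>. ln (X i \<omega>)))"
  \<comment> \<open>the tangent of \<open>exp\<close> at \<open>c\<close>\<close>
  let ?f = "\<lambda>\<omega>. exp c * (1 - c + (\<Sum>i\<in>I. ln (X i \<omega>)))"
  have f_int: "integrable M ?f"
    using int by simp
  have "expectation ?f = exp c"
    using int by (simp add: c_def prob_space)
  then have "ennreal (exp c) \<le> (\<integral>\<^sup>+\<omega>. ennreal (?f \<omega>) \<partial>M)"
    using ennreal_integral_le_nn_integral[OF f_int] by simp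
  also have "\<dots> \<le> (\<integral>\<^sup>+\<omega>. ennreal (\<Prod>i\<in>I. X i \<omega>) \<partial>M)"
  proof (rule nn_integral_mono_AE)
    show "AE \<omega> in M. ennreal (?f \<omega>) \<le> ennreal (\<Prod>i\<in>I. X i \<omega>)"
      using pos
    proof eventually_elim
      case (elim \<omega>)
      let ?s = "\<Sum>i\<in>I. ln (X i \<omega>)"
      \<comment> \<open>This is 1 + y \<le> \<open>exp\<close> y at y = \<open>?s - c\<close>,
        scaled by \<open>exp c\<close>.\<close>
      have "?f \<omega> \<le> exp c * exp (?s - c)"
        using exp_ge_add_one_self[of "?s - c"] by (intro mult_left_mono) (simp_all add: algebra_simps)
      also have "\<dots> = (\<Prod>i\<in>I. exp (ln (X i \<omega>)))"
        by (simp add: exp_add[symmetric] exp_sum[OF I])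
      also have "\<dots> = (\<Prod>i\<in>I. X i \<omega>)"
        using elim by (intro prod.cong) auto
      finally show ?case
        by (rule ennreal_leI)
    qed
  qed
  finally show ?thesis
    by (simp add: c_def)
qed

section \<open>Minimality of the mixing vector\<close>

lemma mixing_attains_m:
  assumes d: "1 \<le> d"
    and sq: "\<And>i. i \<in> {1..d} \<Longrightarrow> square_integrable_df (F i)"
    and X: "has_marginals P d F X"
    and mix: "AE \<omega> in P. (\<Sum>i\<in>{1..d}. ext_ln (X i \<omega>)) = ereal c"
  shows "lower_bound_m d F = ennreal (exp c)" and "attains_m P d F X"
proof -
  interpret P: prob_space P using X d by (auto simp: has_marginals_def has_df_def)
  have Xdf: "has_df P (X i) (F i)" if "i \<in> {1..d}" for i
    using X that by (auto simp: has_marginals_def)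
  have pos: "AE \<omega> in P. \<forall>i\<in>{1..d}. 0 < X i \<omega>"
    using mix by eventually_elim (rule sum_ext_ln_eq_real(1)[OF finite_atLeastAtMost])
  have sum: "AE \<omega> in P. (\<Sum>i\<in>{1..d}. ln (X i \<omega>)) = c"
    using mix by eventually_elim (rule sum_ext_ln_eq_real(2)[OF finite_atLeastAtMost])
  have X_int: "integrable P (X i)" if "i \<in> {1..d}" for i
  proof (rule P.square_integrable_imp_integrable)
    show "X i \<in> borel_measurable P"
      using Xdf[OF that] by (simp add: has_df_def)
    show "integrable P (\<lambda>\<omega>. (X i \<omega>)\<^sup>2)"
      using sq[OF that] Xdf[OF that] by (rule square_integrable_dfD)
  qed
  have ln_int: "integrable P (\<lambda>\<omega>. ln (X i \<omega>))" if "i \<in> {1..d}" for i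
    using that by (intro P.integrable_ln_of_sum_eq[OF _ _ X_int pos sum]) auto
  \<comment> \<open>The sum is almost surely constant, so by linearity the expected logarithms total
    \<open>c\<close>. This total depends on the marginals alone.\<close>
  have "P.expectation (\<lambda>\<omega>. \<Sum>i\<in>{1..d}. ln (X i \<omega>)) = P.expectation (\<lambda>_. c)"
    using sum ln_int by (intro integral_cong_AE borel_measurable_sum borel_measurable_const)
      (blast intro: borel_measurable_integrable)+
  then have c: "(\<Sum>i\<in>{1..d}. P.expectation (\<lambda>\<omega>. ln (X i \<omega>))) = c"
    using ln_int by (simp add: P.prob_space)
  have "expected_product P d X = (\<integral>\<^sup>+\<omega>. ennreal (exp c) \<partial>P)"
    unfolding expected_product_def
  proof (rule nn_integral_cong_AE)
    show "AE \<omega> in P. ennreal (\<Prod>i\<in>{1..d}. X i \<omega>) = ennreal (exp c)"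
      using pos sum
    proof eventually_elim
      case (elim \<omega>)
      have "exp c = (\<Prod>i\<in>{1..d}. exp (ln (X i \<omega>)))"
        unfolding elim(2)[symmetric] by (rule exp_sum) simp
      also have "\<dots> = (\<Prod>i\<in>{1..d}. X i \<omega>)"
        using elim(1) by (intro prod.cong) auto
      finally show ?case by simp
    qed
  qed
  then have eq: "expected_product P d X = ennreal (exp c)"
    by (simp add: P.emeasure_space_1)
  \<comment> \<open>A competitor \<open>Y\<close> need not be mixing, but equal marginal laws give
    it positive factors and integrable logarithms with the same total mean \<open>c\<close>.\<close>
  have ge: "ennreal (exp c) \<le> expected_product Q d Y" if Y: "has_marginals Q d F Y"
    for Q :: "(nat \<Rightarrow> real) measure" and Y
  proof -
    interpret Q: prob_space Q using Y d by (auto simp: has_marginals_def has_df_def)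
    have meas: "X i \<in> borel_measurable P" "Y i \<in> borel_measurable Q" if "i \<in> {1..d}" for i
      using X Y that by (auto simp: has_marginals_def has_df_def)
    have law: "distr P borel (X i) = distr Q borel (Y i)" if "i \<in> {1..d}" for i
      using X Y that by (intro has_df_distr_unique[of _ _ "F i"]) (auto simp: has_marginals_def)
    have "AE \<omega> in Q. 0 < Y i \<omega>" if i: "i \<in> {1..d}" for i
    proof -
      have "AE x in distr P borel (X i). 0 < x"
        using pos i meas by (subst AE_distr_iff) auto
      then show ?thesis
        unfolding law[OF i] using meas[OF i] by (subst (asm) AE_distr_iff) auto
    qed
    then have Y_pos: "AE \<omega> in Q. \<forall>i\<in>{1..d}. 0 < Y i \<omega>"
      by (subst AE_finite_all) auto
    have Y_int: "integrable Q (\<lambda>\<omega>. ln (Y i \<omega>))" if i: "i \<in> {1..d}" for i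
      using ln_int[OF i] law[OF i] integrable_distr_eq[OF meas(1)[OF i], of ln]
        integrable_distr_eq[OF meas(2)[OF i], of ln] by simp
    have "Q.expectation (\<lambda>\<omega>. ln (Y i \<omega>)) = P.expectation (\<lambda>\<omega>. ln (X i \<omega>))" if i: "i \<in> {1..d}" for i
      using law[OF i] integral_distr[OF meas(1)[OF i], of ln]
        integral_distr[OF meas(2)[OF i], of ln] by simp
    then have "(\<Sum>i\<in>{1..d}. Q.expectation (\<lambda>\<omega>. ln (Y i \<omega>))) = c"
      unfolding c[symmetric] by (intro sum.cong) auto
    then show ?thesis
      using Q.nn_integral_prod_ge_exp[OF _ Y_pos Y_int] by (simp add: expected_product_def)
  qed
  show m: "lower_bound_m d F = ennreal (exp c)"
  proof (rule antisym)
    show "lower_bound_m d F \<le> ennreal (exp c)"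
      unfolding lower_bound_m_def eq[symmetric]
      using X d by (intro Inf_lower expected_product_attainable)
    show "ennreal (exp c) \<le> lower_bound_m d F"
      unfolding lower_bound_m_def attainable_expectations_def
      by (intro Inf_greatest) (auto intro: ge)
  qed
  then show "attains_m P d F X"
    using X eq by (simp add: attains_m_def)
qed

theorem proposition3p1:
  fixes d :: nat and F :: "nat \<Rightarrow> real \<Rightarrow> real"
  assumes "d \<ge> 2"
    and "\<And>i. i \<in> {1..d} \<Longrightarrow> distribution_function (F i)"
    and "\<And>i. i \<in> {1..d} \<Longrightarrow> nonneg_domain (F i)"
    and "\<And>i. i \<in> {1..d} \<Longrightarrow> square_integrable_df (F i)"
  shows
    "(\<forall>(P :: 'a measure) X. comonotonic P d F X \<longrightarrow> attains_M P d F X) \<and>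
     (\<forall>(P :: 'b measure) X (c :: real).
        has_marginals P d F X \<and> (AE \<omega> in P. (\<Sum>i\<in>{1..d}. ext_ln (X i \<omega>)) = ereal c) \<longrightarrow>
        lower_bound_m d F = ennreal (exp c) \<and> attains_m P d F X)"
proof -
  have "1 \<le> d"
    using assms(1) by simp
  with assms(2-4) show ?thesis
    \<comment> \<open>Membership in \<open>{1..d}\<close> stays folded, as the premises of the two
      lemmas state it.\<close>
    by (auto intro: comonotonic_attains_M mixing_attains_m simp del: atLeastAtMost_iff)
qed

end
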